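(* Let $T$ be a tree, $f\colon T\to\mathbb{R}$ a discrete Morse function, and $M=M_f$ the merge tree induced by $f$. Then the set of edges of $T$ corresponding to the set of impasses of $M$ forms a matching of $T$. In particular, $i(M)\le \nu(T)$.
   Context: Graphs are finite and simple; a \emph{simplex} of a graph is a vertex or an edge. A tree is a nonempty connected graph without cycles. A matching is a set of edges no two of which share a vertex; $\nu(G)$ is the largest size of a matching of $G$. A function $f$ from the set of simplices of a graph $G$ to $\mathbb{R}$ (written $f\colon G\to\mathbb{R}$) is a \emph{discrete Morse function} if (i) $f(v)\le f(e)$ whenever $v$ is an endpoint of the edge $e$; (ii) $f$ is at most 2--1 (each value is taken by at most two simplices); (iii) if $f(\sigma)=f(\tau)$ then $\sigma\subseteq\tau$ or $\tau\subseteq\sigma$. A simplex $\sigma$ is \emph{critical} if no other simplex has the value $f(\sigma)$; then $f(\sigma)$ is a \emph{critical value}. A \emph{binary tree} is a rooted tree in which each vertex has at most two children, each child being designated as the left (L) or the right (R) child, with at most one of each. It is \emph{full} if every vertex has $0$ or $2$ children. A \emph{merge tree} is a full binary tree. Its vertices are called nodes. A node with exactly one neighbor is a \emph{leaf}; a node with more than one neighbor is an \emph{internal node}. An internal node adjacent to exactly two leaves is an \emph{impasse}; $i(M)$ is the number of impasses of $M$. Construction of $M_f$. For a critical value $c$ let $T_{c-\epsilon}$ be the subgraph of $T$ consisting of all simplices $\sigma$ with $f(\sigma)<c$, and for a vertex $w$ of it let $T_{c-\epsilon}[w]$ be the connected component containing $w$. Each node $x$ of $M_f$ carries a real label $f_M(x)$,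 which is a critical value of $f$, and a direction L or R. (1) Start with a root node, labeled by the largest critical value $c_m$ of $f$, with direction L. (2) Whenever a node $x$ has label $c=f(uv)$ for a critical edge $uv$ of $T$, create two children $n_u,n_v$ of $x$ with labels $f_M(n_u)=\max\{f(\sigma):\sigma\in T_{c-\epsilon}[u],\ \sigma\text{ critical}\}$ and $f_M(n_v)=\max\{f(\sigma):\sigma\in T_{c-\epsilon}[v],\ \sigma\text{ critical}\}$. If $\min\{f(\sigma):\sigma\in T_{c-\epsilon}[u],\ \sigma\text{ critical}\}<\min\{f(\sigma):\sigma\in T_{c-\epsilon}[v],\ \sigma\text{ critical}\}$, give $n_u$ the same direction as $x$ and $n_v$ the opposite direction; if the reverse inequality holds, give $n_v$ the same direction as $x$ and $n_u$ the opposite direction. The child with direction L is the left child and the child with direction R is the right child. (3) A node whose label is the value of a critical vertex gets no children. Continue until all nodes labeled by critical edges have been given children. An internal node $x$ of $M_f$ corresponds to the unique critical edge $e_x$ of $T$ with $f(e_x)=f_M(x)$. *)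

theory Defs
  imports Complex_Main
begin

record 'a graph =
  verts :: "'a set"
  edges :: "'a set set"

definition simple_graph :: "'a graph \<Rightarrow> bool" where
  "simple_graph G \<longleftrightarrow>
    finite (verts G) \<and> (\<forall>e \<in> edges G. e \<subseteq> verts G \<and> card e = 2)"

text \<open>A vertex \<open>v\<close>, seen as a simplex, is the singleton \<open>{v}\<close>; inclusion of simplices is
  then inclusion of sets.\<close>

definition simplices :: "'a graph \<Rightarrow> 'a set set" where
  "simplices G = (\<lambda>v. {v}) ` verts G \<union> edges G"

definition adjacent :: "'a graph \<Rightarrow> 'a \<Rightarrow> 'a \<Rightarrow> bool" where
  "adjacent G u v \<longleftrightarrow> {u, v} \<in> edges G"

definition connected_graph :: "'a graph \<Rightarrow> bool" where
  "connected_graph G \<longleftrightarrow> (\<forall>u \<in> verts G. \<forall>v \<in> verts G. (adjacent G)\<^sup>*\<^sup>* u v)"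

definition is_cycle :: "'a graph \<Rightarrow> 'a list \<Rightarrow> bool" where
  "is_cycle G vs \<longleftrightarrow>
    length vs \<ge> 3 \<and> distinct vs \<and>
    successively (adjacent G) vs \<and> adjacent G (last vs) (hd vs)"

definition is_tree :: "'a graph \<Rightarrow> bool" where
  "is_tree G \<longleftrightarrow>
    simple_graph G \<and> verts G \<noteq> {} \<and> connected_graph G \<and> (\<nexists>vs. is_cycle G vs)"

definition component :: "'a graph \<Rightarrow> 'a \<Rightarrow> 'a graph" where
  "component G w =
    (let C = {v \<in> verts G. (adjacent G)\<^sup>*\<^sup>* w v}
     in \<lparr>verts = C, edges = {e \<in> edges G. e \<subseteq> C}\<rparr>)"

definition matching :: "'a graph \<Rightarrow> 'a set set \<Rightarrow> bool" where
  "matching G m \<longleftrightarrow>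
    m \<subseteq> edges G \<and> (\<forall>e \<in> m. \<forall>e' \<in> m. e \<noteq> e' \<longrightarrow> e \<inter> e' = {})"

definition matching_number :: "'a graph \<Rightarrow> nat" where
  "matching_number G = Max (card ` {m. matching G m})"

definition neighbors :: "'a graph \<Rightarrow> 'a \<Rightarrow> 'a set" where
  "neighbors G x = {y \<in> verts G. adjacent G x y}"

text \<open>Only the values of \<open>f\<close> on the simplices of \<open>G\<close> are relevant.\<close>

definition discrete_morse :: "'a graph \<Rightarrow> ('a set \<Rightarrow> real) \<Rightarrow> bool" where
  "discrete_morse G f \<longleftrightarrow>
    (\<forall>e \<in> edges G. \<forall>v \<in> e. f {v} \<le> f e) \<and>
    (\<forall>r. card {\<sigma> \<in> simplices G. f \<sigma> = r} \<le> 2) \<and>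
    (\<forall>\<sigma> \<in> simplices G. \<forall>\<tau> \<in> simplices G. f \<sigma> = f \<tau> \<longrightarrow> \<sigma> \<subseteq> \<tau> \<or> \<tau> \<subseteq> \<sigma>)"

definition critical :: "'a graph \<Rightarrow> ('a set \<Rightarrow> real) \<Rightarrow> 'a set \<Rightarrow> bool" where
  "critical G f \<sigma> \<longleftrightarrow>
    \<sigma> \<in> simplices G \<and> (\<forall>\<tau> \<in> simplices G. \<tau> \<noteq> \<sigma> \<longrightarrow> f \<tau> \<noteq> f \<sigma>)"

definition critical_values :: "'a graph \<Rightarrow> ('a set \<Rightarrow> real) \<Rightarrow> real set" where
  "critical_values G f = f ` {\<sigma>. critical G f \<sigma>}"

definition strict_sublevel :: "'a graph \<Rightarrow> ('a set \<Rightarrow> real) \<Rightarrow> real \<Rightarrow> 'a graph" where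
  "strict_sublevel G f c =
    \<lparr>verts = {v \<in> verts G. f {v} < c}, edges = {e \<in> edges G. f e < c}\<rparr>"

text \<open>The values of the critical simplices of \<open>G\<close> lying in the component of \<open>w\<close> in the
  strict sublevel graph; criticality refers to all of \<open>G\<close>.\<close>

definition component_critical_values ::
    "'a graph \<Rightarrow> ('a set \<Rightarrow> real) \<Rightarrow> real \<Rightarrow> 'a \<Rightarrow> real set" where
  "component_critical_values G f c w =
    f ` {\<sigma> \<in> simplices (component (strict_sublevel G f c) w). critical G f \<sigma>}"

datatype direction = Left | Right

fun opposite :: "direction \<Rightarrow> direction" where
  "opposite Left = Right"
| "opposite Right = Left"

text \<open>A node of a binary tree is identified with the word of directions leading to it from
  the root: the root is \<open>[]\<close>, and the left and right child of \<open>x\<close> are \<open>x @ [Left]\<close> and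
  \<open>x @ [Right]\<close>.\<close>

type_synonym node = "direction list"

record labeled_binary_tree =
  nodes :: "node set"
  label :: "node \<Rightarrow> real"

definition node_direction :: "node \<Rightarrow> direction" where
  "node_direction x = (if x = [] then Left else last x)"

definition full_binary_tree :: "labeled_binary_tree \<Rightarrow> bool" where
  "full_binary_tree M \<longleftrightarrow>
    [] \<in> nodes M \<and> (\<forall>x d. x @ [d] \<in> nodes M \<longrightarrow> x \<in> nodes M) \<and>
    (\<forall>x \<in> nodes M. x @ [Left] \<in> nodes M \<longleftrightarrow> x @ [Right] \<in> nodes M)"

definition underlying_graph :: "labeled_binary_tree \<Rightarrow> node graph" where
  "underlying_graph M =
    \<lparr>verts = nodes M,
     edges = {{x, x @ [d]} | x d. x \<in> nodes M \<and> x @ [d] \<in> nodes M}\<rparr>"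

definition leaf :: "labeled_binary_tree \<Rightarrow> node \<Rightarrow> bool" where
  "leaf M x \<longleftrightarrow> x \<in> nodes M \<and> card (neighbors (underlying_graph M) x) = 1"

definition internal :: "labeled_binary_tree \<Rightarrow> node \<Rightarrow> bool" where
  "internal M x \<longleftrightarrow> x \<in> nodes M \<and> card (neighbors (underlying_graph M) x) > 1"

definition impasses :: "labeled_binary_tree \<Rightarrow> node set" where
  "impasses M =
    {x. internal M x \<and> card {y \<in> neighbors (underlying_graph M) x. leaf M y} = 2}"

definition num_impasses :: "labeled_binary_tree \<Rightarrow> nat" where
  "num_impasses M = card (impasses M)"

text \<open>\<open>induced_node T f x c\<close> means that \<open>x\<close> is a node of the induced merge tree, with
  label \<open>c\<close>. In the last two rules \<open>u\<close> is the endpoint whose component contains the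
  smaller minimum; since \<open>{u, v} = {v, u}\<close>, this covers both orientations of the edge.\<close>

inductive induced_node ::
    "'a graph \<Rightarrow> ('a set \<Rightarrow> real) \<Rightarrow> node \<Rightarrow> real \<Rightarrow> bool"
  for T :: "'a graph" and f :: "'a set \<Rightarrow> real" where
  root: "induced_node T f [] (Max (critical_values T f))"
| same_direction:
    "\<lbrakk>induced_node T f x c; {u, v} \<in> edges T; critical T f {u, v}; c = f {u, v};
      Min (component_critical_values T f c u) < Min (component_critical_values T f c v)\<rbrakk>
     \<Longrightarrow> induced_node T f (x @ [node_direction x])
           (Max (component_critical_values T f c u))"
| opposite_direction:
    "\<lbrakk>induced_node T f x c; {u, v} \<in> edges T; critical T f {u, v}; c = f {u, v};
      Min (component_critical_values T f c u) < Min (component_critical_values T f c v)\<rbrakk>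
     \<Longrightarrow> induced_node T f (x @ [opposite (node_direction x)])
           (Max (component_critical_values T f c v))"

lemma opposite_neq [simp]: "opposite d \<noteq> d" "d \<noteq> opposite d"
  by (cases d; simp)+

lemma critical_unique:
  assumes "critical T f \<sigma>" and "critical T f \<tau>" and "f \<sigma> = f \<tau>"
  shows "\<sigma> = \<tau>"
  using assms unfolding critical_def by metis

lemma induced_node_label_unique:
  assumes "induced_node T f x c" and "induced_node T f x c'"
  shows "c = c'"
  using assms
proof (induction arbitrary: c' rule: induced_node.induct)
  case root
  then show ?case by cases auto
next
  case (same_direction x c u v)
  from same_direction.prems show ?case
  proof cases
    case (same_direction y d u' v')
    then have "d = c" using same_direction.IH by simp
    with same_direction \<open>c = f {u, v}\<close> \<open>critical T f {u, v}\<close> have "{u, v} = {u', v'}"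
      by (metis critical_unique)
    with same_direction \<open>d = c\<close> same_direction.hyps show ?thesis
      by (auto simp: doubleton_eq_iff)
  qed auto
next
  case (opposite_direction x c u v)
  from opposite_direction.prems show ?case
  proof cases
    case (opposite_direction y d u' v')
    then have "d = c" using opposite_direction.IH by simp
    with opposite_direction \<open>c = f {u, v}\<close> \<open>critical T f {u, v}\<close> have "{u, v} = {u', v'}"
      by (metis critical_unique)
    with opposite_direction \<open>d = c\<close> opposite_direction.hyps show ?thesis
      by (auto simp: doubleton_eq_iff)
  qed auto
qed

definition induced_merge_tree ::
    "'a graph \<Rightarrow> ('a set \<Rightarrow> real) \<Rightarrow> labeled_binary_tree" where
  "induced_merge_tree T f =
    \<lparr>nodes = {x. \<exists>c. induced_node T f x c},
     label = (\<lambda>x. THE c. induced_node T f x c)\<rparr>"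

lemma induced_node_child_iff:
  "(\<exists>c. induced_node T f (x @ [d]) c) \<longleftrightarrow>
   (\<exists>c u v. induced_node T f x c \<and> {u, v} \<in> edges T \<and> critical T f {u, v} \<and> c = f {u, v} \<and>
      Min (component_critical_values T f c u) < Min (component_critical_values T f c v))"
    (is "?l \<longleftrightarrow> ?r")
proof
  assume ?l
  then obtain c where "induced_node T f (x @ [d]) c" by blast
  then show ?r by cases auto
next
  assume ?r
  moreover have "d = node_direction x \<or> d = opposite (node_direction x)"
    by (cases d; cases "node_direction x") auto
  ultimately show ?l
    using same_direction opposite_direction by metis
qed

lemma full_binary_tree_induced_merge_tree: "full_binary_tree (induced_merge_tree T f)"
  using induced_node.root[of T f]
  by (auto simp: full_binary_tree_def induced_merge_tree_def induced_node_child_iff)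

definition corresponding_edge ::
    "'a graph \<Rightarrow> ('a set \<Rightarrow> real) \<Rightarrow> labeled_binary_tree \<Rightarrow> node \<Rightarrow> 'a set" where
  "corresponding_edge T f M x =
    (THE e. e \<in> edges T \<and> critical T f e \<and> f e = label M x)"

end

theory Submission imports Defs "HOL-Library.Sublist" begin

text \<open>Both children of an impasse are leaves, so neither of the two components joined by its
  edge contains a critical edge: if a component contains a critical edge, then its largest
  critical value is attained by an edge. Of two critical edges sharing a vertex \<open>v\<close>, however, the
  lower one lies in the component of \<open>v\<close> joined by the higher one. Labels of nodes are pairwise
  distinct, because the labels below a node lie in disjoint components strictly below it, so
  distinct impasses have distinct edges.\<close>

section \<open>Paths and bridges in acyclic graphs\<close>

lemma adjacent_sym: "adjacent G u v \<Longrightarrow> adjacent G v u"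
  by (simp add: adjacent_def insert_commute)

lemma adjacent_rtranclp_sym: "(adjacent G)\<^sup>*\<^sup>* u v \<Longrightarrow> (adjacent G)\<^sup>*\<^sup>* v u"
  by (metis adjacent_sym sympI symp_rtranclp sympE)

text \<open>A step to a new vertex extends the path; a step to a vertex already visited cuts the
  path back to that vertex.\<close>

lemma rtranclp_imp_distinct_path:
  assumes "R\<^sup>*\<^sup>* x y"
  shows "\<exists>vs. vs \<noteq> [] \<and> distinct vs \<and> successively R vs \<and> hd vs = x \<and> last vs = y"
  using assms
proof induction
  case base
  show ?case by (rule exI[of _ "[x]"]) simp
next
  case (step y z)
  then obtain vs where vs: "vs \<noteq> []" "distinct vs" "successively R vs" "hd vs = x" "last vs = y"
    by blast
  show ?case
  proof (cases "z \<in> set vs")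
    case True
    then obtain as bs where "vs = as @ z # bs" by (meson split_list)
    then have "vs = (as @ [z]) @ bs" by simp
    with vs show ?thesis
      by (intro exI[of _ "as @ [z]"]) (auto simp: successively_append_iff hd_append split: if_splits)
  next
    case False
    with vs step.hyps show ?thesis
      by (intro exI[of _ "vs @ [z]"]) (auto simp: successively_append_iff)
  qed
qed

text \<open>A path in \<open>H\<close> from \<open>u\<close> to \<open>v\<close> would close up with
  \<open>{u, v}\<close> to a cycle of \<open>G\<close>. Below, \<open>H\<close> is the strict
  sublevel graph at the value of the edge, which omits that edge.\<close>

lemma acyclic_edge_disconnects:
  assumes "\<nexists>vs. is_cycle G vs" and "{u, v} \<in> edges G" and "u \<noteq> v"
    and H: "edges H \<subseteq> edges G" "{u, v} \<notin> edges H"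
  shows "\<not> (adjacent H)\<^sup>*\<^sup>* u v"
proof
  assume "(adjacent H)\<^sup>*\<^sup>* u v"
  then obtain vs where vs: "vs \<noteq> []" "distinct vs" "successively (adjacent H) vs"
      "hd vs = u" "last vs = v"
    using rtranclp_imp_distinct_path by metis
  \<comment> \<open>A single vertex would give \<open>u = v\<close>, and two vertices would make
    \<open>{u, v}\<close> an edge of \<open>H\<close>.\<close>
  have "length vs \<ge> 3"
  proof (rule ccontr)
    assume "\<not> length vs \<ge> 3"
    then consider a where "vs = [a]" | a b where "vs = [a, b]"
      using \<open>vs \<noteq> []\<close> by (cases vs; cases "tl vs"; cases "tl (tl vs)") auto
    then show False
      using vs \<open>u \<noteq> v\<close> H(2) by cases (auto simp: adjacent_def)
  qed
  moreover have "successively (adjacent G) vs"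
    using vs(3) H(1) by (auto elim!: successively_mono simp: adjacent_def)
  moreover have "adjacent G (last vs) (hd vs)"
    using vs assms(2) by (simp add: adjacent_def insert_commute)
  ultimately have "is_cycle G vs" using vs by (simp add: is_cycle_def)
  with assms(1) show False by blast
qed

lemma component_critical_values_iff:
  "r \<in> component_critical_values G f c w \<longleftrightarrow>
    (\<exists>\<sigma>. r = f \<sigma> \<and> critical G f \<sigma> \<and> \<sigma> \<in> simplices (component (strict_sublevel G f c) w))"
  by (auto simp: component_critical_values_def)

section \<open>Simplices of the tree and coincidences among their values\<close>

locale morse_tree =
  fixes T :: "'a graph" and f :: "'a set \<Rightarrow> real"
  assumes tree: "is_tree T" and morse: "discrete_morse T f"
begin

lemma edge_subset: "e \<in> edges T \<Longrightarrow> e \<subseteq> verts T"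
  and edge_card: "e \<in> edges T \<Longrightarrow> card e = 2"
  and finite_verts: "finite (verts T)"
  and no_cycle: "\<nexists>vs. is_cycle T vs"
  using tree by (auto simp: is_tree_def simple_graph_def)

lemma edge_distinct: "{u, v} \<in> edges T \<Longrightarrow> u \<noteq> v"
  using edge_card by fastforce

lemma edge_other_end:
  assumes "e \<in> edges T" "v \<in> e"
  obtains w where "e = {v, w}" "w \<noteq> v"
proof -
  obtain a b where "e = {a, b}" "a \<noteq> b"
    using edge_card[OF assms(1)] by (auto simp: card_2_iff)
  then show thesis using assms(2) that by (metis insertE insert_commute singletonD)
qed

lemma finite_edges: "finite (edges T)"
  using finite_verts edge_subset by (meson finite_Pow_iff finite_subset PowI subsetI)

lemma finite_simplices: "finite (simplices T)"
  using finite_verts finite_edges by (simp add: simplices_def)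

lemma vertex_le_edge: "e \<in> edges T \<Longrightarrow> v \<in> e \<Longrightarrow> f {v} \<le> f e"
  using morse by (auto simp: discrete_morse_def)

lemma vertex_simplex: "v \<in> verts T \<Longrightarrow> {v} \<in> simplices T"
  and edge_simplex: "e \<in> edges T \<Longrightarrow> e \<in> simplices T"
  by (auto simp: simplices_def)

lemma simplex_nonempty: "\<sigma> \<in> simplices T \<Longrightarrow> \<sigma> \<noteq> {}"
  using edge_card by (fastforce simp: simplices_def)

text \<open>\<open>f\<close> is at most 2--1, and \<open>e\<close> and \<open>{v}\<close> already
  use up the value.\<close>

lemma same_value_cases:
  assumes "e \<in> edges T" "v \<in> e" "f {v} = f e" "\<sigma> \<in> simplices T" "f \<sigma> = f e"
  shows "\<sigma> = e \<or> \<sigma> = {v}"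
proof (rule ccontr)
  assume "\<not> ?thesis"
  moreover have "e \<noteq> {v}" using edge_card[OF assms(1)] by auto
  ultimately have "card {e, {v}, \<sigma>} = 3" by (simp add: card_insert_if) metis
  moreover have "{e, {v}, \<sigma>} \<subseteq> {\<sigma> \<in> simplices T. f \<sigma> = f e}"
    using assms edge_subset vertex_simplex edge_simplex by auto
  then have "card {e, {v}, \<sigma>} \<le> card {\<sigma> \<in> simplices T. f \<sigma> = f e}"
    using finite_simplices by (intro card_mono) auto
  moreover have "card {\<sigma> \<in> simplices T. f \<sigma> = f e} \<le> 2"
    using morse by (auto simp: discrete_morse_def)
  ultimately show False by simp
qed

lemma critical_edge_gt:
  assumes "critical T f e" "e \<in> edges T" "v \<in> e"
  shows "f {v} < f e"
proof -
  have "{v} \<in> simplices T" "{v} \<noteq> e"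
    using assms edge_subset[of e] edge_card[of e] vertex_simplex by auto
  then have "f {v} \<noteq> f e" using assms(1) by (auto simp: critical_def)
  then show ?thesis using vertex_le_edge[OF assms(2,3)] by simp
qed

text \<open>A second simplex with the value of \<open>e\<close> is comparable with \<open>e\<close>;
  it is not an edge, since nested sets of size two are equal.\<close>

lemma noncritical_edge:
  assumes "\<not> critical T f e" "e \<in> edges T"
  obtains v where "v \<in> e" "f {v} = f e"
proof -
  obtain \<tau> where \<tau>: "\<tau> \<in> simplices T" "\<tau> \<noteq> e" "f \<tau> = f e"
    using assms by (auto simp: critical_def edge_simplex)
  then have "\<tau> \<subseteq> e \<or> e \<subseteq> \<tau>"
    using morse edge_simplex[OF assms(2)] unfolding discrete_morse_def by blast
  moreover have "\<tau> \<notin> edges T"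
  proof
    assume "\<tau> \<in> edges T"
    with \<open>\<tau> \<subseteq> e \<or> e \<subseteq> \<tau>\<close> show False
      using \<tau>(2) edge_card assms(2) by (metis card.infinite card_subset_eq zero_neq_numeral)
  qed
  ultimately obtain v where "\<tau> = {v}" "v \<in> e"
    using \<tau>(1) edge_card[OF assms(2)] by (auto simp: simplices_def subset_singleton_iff)
  with \<tau> that show thesis by blast
qed

lemma noncritical_vertex:
  assumes "\<not> critical T f {v}" "v \<in> verts T"
  obtains e where "e \<in> edges T" "v \<in> e" "f {v} = f e"
proof -
  obtain \<tau> where \<tau>: "\<tau> \<in> simplices T" "\<tau> \<noteq> {v}" "f \<tau> = f {v}"
    using assms by (auto simp: critical_def vertex_simplex)
  then have "\<tau> \<subseteq> {v} \<or> {v} \<subseteq> \<tau>"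
    using morse vertex_simplex[OF assms(2)] unfolding discrete_morse_def by blast
  then have "v \<in> \<tau>"
    using \<tau>(2) simplex_nonempty[OF \<tau>(1)] by (auto simp: subset_singleton_iff)
  moreover then have "\<tau> \<in> edges T"
    using \<tau>(1,2) by (auto simp: simplices_def)
  ultimately show thesis using \<tau>(3) that by metis
qed

section \<open>Components of strict sublevel graphs and their critical values\<close>

abbreviation sublevel_adj :: "real \<Rightarrow> 'a \<Rightarrow> 'a \<Rightarrow> bool" where
  "sublevel_adj c \<equiv> adjacent (strict_sublevel T f c)"

abbreviation piece :: "real \<Rightarrow> 'a \<Rightarrow> 'a graph" where
  "piece c w \<equiv> component (strict_sublevel T f c) w"

abbreviation piece_values :: "real \<Rightarrow> 'a \<Rightarrow> real set" where
  "piece_values c w \<equiv> component_critical_values T f c w"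

lemma sublevel_adj_iff: "sublevel_adj c u v \<longleftrightarrow> {u, v} \<in> edges T \<and> f {u, v} < c"
  by (simp add: adjacent_def strict_sublevel_def)

lemma verts_piece: "v \<in> verts (piece c w) \<longleftrightarrow> v \<in> verts T \<and> f {v} < c \<and> (sublevel_adj c)\<^sup>*\<^sup>* w v"
  by (auto simp: component_def Let_def strict_sublevel_def)

lemma edges_piece: "e \<in> edges (piece c w) \<longleftrightarrow> e \<in> edges T \<and> f e < c \<and> e \<subseteq> verts (piece c w)"
  by (auto simp: component_def Let_def strict_sublevel_def)

lemma simplices_piece:
  "\<sigma> \<in> simplices (piece c w) \<longleftrightarrow> \<sigma> \<in> simplices T \<and> f \<sigma> < c \<and> \<sigma> \<subseteq> verts (piece c w)"
proof -
  have "v \<in> verts (piece c w) \<Longrightarrow> v \<in> verts T \<and> f {v} < c" for v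
    by (simp add: verts_piece)
  then show ?thesis by (auto simp: simplices_def edges_piece)
qed

text \<open>The far end of \<open>e\<close> lies below \<open>c\<close> because its value is at most
  that of \<open>e\<close>, and \<open>e\<close> itself connects it to \<open>v\<close>.\<close>

lemma edge_in_piece:
  assumes "v \<in> verts (piece c w)" "e \<in> edges T" "v \<in> e" "f e < c"
  shows "e \<in> edges (piece c w)"
proof -
  obtain q where q: "e = {v, q}" using edge_other_end assms by metis
  have "sublevel_adj c v q" using assms q by (simp add: sublevel_adj_iff)
  then have "(sublevel_adj c)\<^sup>*\<^sup>* w q"
    using assms(1) verts_piece by (meson rtranclp.rtrancl_into_rtrancl)
  moreover have "f {q} < c" "q \<in> verts T"
    using vertex_le_edge[of e q] edge_subset[of e] assms q by auto
  ultimately have "q \<in> verts (piece c w)" by (simp add: verts_piece)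
  then show ?thesis using assms q by (simp add: edges_piece)
qed

lemma finite_critical_values: "finite (critical_values T f)"
proof -
  have "{\<sigma>. critical T f \<sigma>} \<subseteq> simplices T" by (auto simp: critical_def)
  then show ?thesis
    unfolding critical_values_def using finite_simplices finite_subset by blast
qed

lemma piece_values_subset: "piece_values c w \<subseteq> critical_values T f"
  by (auto simp: component_critical_values_def critical_values_def)

lemma finite_piece_values: "finite (piece_values c w)"
  using piece_values_subset finite_critical_values finite_subset by blast

lemma piece_values_less: "r \<in> piece_values c w \<Longrightarrow> r < c"
  by (auto simp: component_critical_values_iff simplices_piece)

text \<open>A vertex of minimal value in the piece is critical: an edge paired with it would share its value with
  the other endpoint as well.\<close>

lemma piece_values_nonempty:
  assumes "w \<in> verts T" "f {w} < c"
  shows "piece_values c w \<noteq> {}"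
proof -
  let ?C = "verts (piece c w)"
  have "w \<in> ?C" using assms by (simp add: verts_piece)
  moreover have "finite ?C"
    by (rule finite_subset[OF _ finite_verts]) (auto simp: verts_piece)
  ultimately obtain z where z: "z \<in> ?C" and zmin: "\<And>y. y \<in> ?C \<Longrightarrow> f {z} \<le> f {y}"
    using arg_min_if_finite[of ?C "\<lambda>y. f {y}"] by (metis empty_iff leI)
  have zT: "z \<in> verts T" "f {z} < c" using z by (auto simp: verts_piece)
  have "critical T f {z}"
  proof (rule ccontr)
    assume "\<not> critical T f {z}"
    then obtain e where e: "e \<in> edges T" "z \<in> e" "f {z} = f e"
      using noncritical_vertex zT by metis
    then obtain q where q: "e = {z, q}" "q \<noteq> z" using edge_other_end by metis
    have "e \<in> edges (piece c w)" using edge_in_piece z e zT by simp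
    then have "q \<in> ?C" using q by (auto simp: edges_piece)
    then have "f {q} = f e"
      using zmin[of q] vertex_le_edge[OF e(1), of q] e(3) q by simp
    then have "{q} = e \<or> {q} = {z}"
      using same_value_cases[OF e vertex_simplex] \<open>q \<in> ?C\<close> by (auto simp: verts_piece)
    then show False using q by auto
  qed
  moreover have "{z} \<in> simplices (piece c w)" using z by (simp add: simplices_def)
  ultimately have "f {z} \<in> piece_values c w"
    unfolding component_critical_values_iff by blast
  then show ?thesis by blast
qed

text \<open>Criticality puts both ends strictly below the edge, hence into the sublevel graph. So
  every \<open>Min\<close> and \<open>Max\<close> in the construction is taken over a nonempty
  set.\<close>

lemma critical_edge_piece_values:
  assumes "{u, v} \<in> edges T" "critical T f {u, v}"
  shows "piece_values (f {u, v}) u \<noteq> {}" "piece_values (f {u, v}) v \<noteq> {}"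
  using assms edge_subset[of "{u, v}"] critical_edge_gt[of "{u, v}"]
  by (simp_all add: piece_values_nonempty)

text \<open>A critical value determines its simplex, so a common value would give a simplex in both
  components. A vertex of it would then link \<open>u\<close> to \<open>v\<close> without the
  edge.\<close>

lemma piece_values_disjoint:
  assumes "{u, v} \<in> edges T"
  shows "piece_values (f {u, v}) u \<inter> piece_values (f {u, v}) v = {}"
proof (rule ccontr)
  let ?c = "f {u, v}"
  assume "\<not> ?thesis"
  then obtain \<sigma> \<tau> where \<sigma>: "critical T f \<sigma>" "\<sigma> \<in> simplices (piece ?c u)"
      and \<tau>: "critical T f \<tau>" "\<tau> \<in> simplices (piece ?c v)" and "f \<sigma> = f \<tau>"
    by (auto simp: component_critical_values_iff)
  then have "\<sigma> = \<tau>" using critical_unique by metis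
  then have "\<sigma> \<noteq> {}" "\<sigma> \<subseteq> verts (piece ?c u)" "\<sigma> \<subseteq> verts (piece ?c v)"
    using \<sigma> \<tau> simplex_nonempty[of \<sigma>] by (simp_all add: simplices_piece)
  then obtain y where "y \<in> verts (piece ?c u)" "y \<in> verts (piece ?c v)" by blast
  then have "(sublevel_adj ?c)\<^sup>*\<^sup>* u v"
    by (meson verts_piece adjacent_rtranclp_sym rtranclp_trans)
  moreover have "\<not> (sublevel_adj ?c)\<^sup>*\<^sup>* u v"
    using assms edge_distinct no_cycle
    by (intro acyclic_edge_disconnects[of T]) (auto simp: strict_sublevel_def)
  ultimately show False by contradiction
qed

text \<open>The minima are members of disjoint sets. Hence one orientation of the edge satisfies the
  strict inequality demanded by the rules of \<open>induced_node\<close>.\<close>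

lemma Min_piece_values_neq:
  assumes "{u, v} \<in> edges T" "critical T f {u, v}"
  shows "Min (piece_values (f {u, v}) u) \<noteq> Min (piece_values (f {u, v}) v)"
  using piece_values_disjoint[OF assms(1)] critical_edge_piece_values[OF assms]
    finite_piece_values Min_in by (metis disjoint_iff)

section \<open>Gradient flow and the largest critical value of a component\<close>

text \<open>The upward gradient flow: from \<open>p\<close> it crosses an edge whose value is shared
  by the far end \<open>q\<close>.\<close>

inductive gradient_reach :: "'a \<Rightarrow> 'a \<Rightarrow> bool" for z where
  start: "gradient_reach z z"
| step: "\<lbrakk>gradient_reach z p; {p, q} \<in> edges T; f {p} < f {p, q}; f {q} = f {p, q}\<rbrakk>
    \<Longrightarrow> gradient_reach z q"

lemma gradient_reach_le: "gradient_reach z p \<Longrightarrow> f {z} \<le> f {p}"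
  by (induction rule: gradient_reach.induct) auto

text \<open>If all critical edges of the piece lie below the critical vertex \<open>z\<close>, then every edge
  leaving a vertex reached by the upward flow from \<open>z\<close> is either the one it arrived through
  or is paired with its far end, so the flow from \<open>z\<close> covers the piece.\<close>

lemma no_critical_edge_if_Max_vertex:
  assumes z: "critical T f {z}" "z \<in> verts (piece c w)"
    and max: "\<And>e. e \<in> edges (piece c w) \<Longrightarrow> critical T f e \<Longrightarrow> f e < f {z}"
    and e: "e \<in> edges (piece c w)" "critical T f e"
  shows False
proof -
  have reach: "gradient_reach z p \<and> p \<in> verts (piece c w)" if "(sublevel_adj c)\<^sup>*\<^sup>* z p" for p
    using that
  proof induction
    case base
    show ?case using z gradient_reach.start by simp
  next
    case (step p q)
    then have pq: "{p, q} \<in> edges T" "f {p, q} < c" by (auto simp: sublevel_adj_iff)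
    have pqC: "{p, q} \<in> edges (piece c w)"
      using edge_in_piece[of p c w "{p, q}"] step.IH pq by simp
    have "gradient_reach z q"
    proof (cases "f {p} = f {p, q}")
      case True
      \<comment> \<open>The critical vertex \<open>z\<close> shares its value with no edge, so
        \<open>p\<close> was entered by a flow step.\<close>
      have "p \<noteq> z"
      proof
        assume "p = z"
        then have "{z} = {p, q}"
          using z(1) True edge_simplex[OF pq(1)] by (metis critical_def)
        then show False using \<open>p = z\<close> edge_distinct[OF pq(1)] by auto
      qed
      from step.IH have "gradient_reach z p" by simp
      then show ?thesis
      proof cases
        case (step p')
        \<comment> \<open>Both edges have the value of \<open>p\<close>, and only one edge can share
          it.\<close>
        then have "{p', p} = {p, q}"
          using same_value_cases[OF pq(1) _ True, of "{p', p}"] True edge_simplex edge_distinct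
          by (metis doubleton_eq_iff insert_absorb2 insertI1)
        then have "p' = q" by (auto simp: doubleton_eq_iff)
        with step show ?thesis by simp
      qed (use \<open>p \<noteq> z\<close> in simp)
    next
      case False
      then have less: "f {p} < f {p, q}" using vertex_le_edge[OF pq(1), of p] by simp
      then have "f {z} < f {p, q}" using gradient_reach_le step.IH by fastforce
      then have "\<not> critical T f {p, q}" using max[OF pqC] by auto
      then have "f {q} = f {p, q}" using noncritical_edge[OF _ pq(1)] False by blast
      then show ?thesis using gradient_reach.step step.IH pq less by blast
    qed
    then show ?case using pqC by (simp add: edges_piece)
  qed
  \<comment> \<open>Values do not decrease along the flow, so reaching an end of \<open>e\<close>
    puts \<open>f e\<close> at or above \<open>f {z}\<close>, against \<open>max\<close>.\<close>
  obtain v where v: "v \<in> e"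
    using simplex_nonempty e by (fastforce simp: critical_def)
  then have "(sublevel_adj c)\<^sup>*\<^sup>* z v"
    using e z(2) unfolding edges_piece by (meson verts_piece subsetD adjacent_rtranclp_sym rtranclp_trans)
  then have "f {z} \<le> f {v}" using reach gradient_reach_le by blast
  also have "\<dots> \<le> f e" using v e vertex_le_edge by (simp add: edges_piece)
  also have "\<dots> < f {z}" using max e by blast
  finally show False by simp
qed

text \<open>If the maximum were taken at a critical vertex, every critical edge of the component
  would lie strictly below it, which the flow argument excludes.\<close>

lemma Max_piece_values_edge:
  assumes "e \<in> edges (piece c w)" "critical T f e"
  obtains e' where "e' \<in> edges T" "critical T f e'" "Max (piece_values c w) = f e'"
proof -
  let ?K = "piece_values c w"
  have in_K: "f \<sigma> \<in> ?K" if "\<sigma> \<in> edges (piece c w)" "critical T f \<sigma>" for \<sigma>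
    using that by (auto simp: component_critical_values_iff simplices_def)
  then have "Max ?K \<in> ?K" using assms finite_piece_values Max_in by (metis empty_iff)
  then obtain \<sigma> where \<sigma>: "Max ?K = f \<sigma>" "critical T f \<sigma>" "\<sigma> \<in> simplices (piece c w)"
    by (auto simp: component_critical_values_iff)
  show thesis
  proof (cases "\<sigma> \<in> edges T")
    case True
    with \<sigma> that show thesis by blast
  next
    case False
    then obtain z where z: "\<sigma> = {z}" "z \<in> verts (piece c w)"
      using \<sigma>(3) by (auto simp: simplices_def edges_piece)
    have "f e' < f {z}" if e': "e' \<in> edges (piece c w)" "critical T f e'" for e'
    proof -
      have "f e' \<le> f {z}" using Max_ge[OF finite_piece_values in_K[OF e']] \<sigma>(1) z(1) by simp
      moreover have "f e' \<noteq> f {z}"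
        using critical_unique[OF e'(2) \<sigma>(2)] False e'(1) z(1) by (auto simp: edges_piece)
      ultimately show ?thesis by simp
    qed
    then show thesis
      using no_critical_edge_if_Max_vertex assms \<sigma>(2) z by blast
  qed
qed

section \<open>Descendants in the induced merge tree and distinctness of labels\<close>

text \<open>The two minima differ, so one of the orderings of the ends of \<open>e\<close> fits the
  rules, which then provide children in both directions.\<close>

lemma induced_node_child_ex:
  assumes "induced_node T f x (f e)" "e \<in> edges T" "critical T f e"
  shows "\<exists>c. induced_node T f (x @ [d]) c"
proof -
  obtain u v where e: "e = {u, v}" using edge_card[OF assms(2)] by (auto simp: card_2_iff)
  have e': "e = {v, u}" using e by (simp add: insert_commute)
  have "Min (piece_values (f e) u) \<noteq> Min (piece_values (f e) v)"
    using Min_piece_values_neq assms e by simp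
  then consider "Min (piece_values (f e) u) < Min (piece_values (f e) v)"
    | "Min (piece_values (f e) v) < Min (piece_values (f e) u)"
    by linarith
  then show ?thesis
  proof cases
    case 1
    then show ?thesis
      unfolding induced_node_child_iff using assms e
      by (intro exI[of _ "f e"] exI[of _ u] exI[of _ v]) simp
  next
    case 2
    then show ?thesis
      unfolding induced_node_child_iff using assms e'
      by (intro exI[of _ "f e"] exI[of _ v] exI[of _ u]) simp
  qed
qed

text \<open>Lowering the threshold from \<open>c\<close> to \<open>f {u, v}\<close> only removes
  simplices, so whatever \<open>u\<close> still reaches stays in the component of
  \<open>w\<close>.\<close>

lemma piece_values_mono:
  assumes "{u, v} \<in> edges (piece c w)"
  shows "piece_values (f {u, v}) u \<subseteq> piece_values c w"
proof
  fix r assume "r \<in> piece_values (f {u, v}) u"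
  then obtain \<sigma> where \<sigma>: "r = f \<sigma>" "critical T f \<sigma>" "\<sigma> \<in> simplices (piece (f {u, v}) u)"
    by (auto simp: component_critical_values_iff)
  have c: "f {u, v} < c" "u \<in> verts (piece c w)" using assms by (auto simp: edges_piece)
  have "y \<in> verts (piece c w)" if "y \<in> verts (piece (f {u, v}) u)" for y
  proof -
    have "(sublevel_adj (f {u, v}))\<^sup>*\<^sup>* u y" using that by (simp add: verts_piece)
    then have "(sublevel_adj c)\<^sup>*\<^sup>* u y"
      using c(1) by (elim mono_rtranclp[rule_format, rotated]) (auto simp: sublevel_adj_iff)
    then show ?thesis using that c by (auto simp: verts_piece)
  qed
  then have "\<sigma> \<in> simplices (piece c w)"
    using \<sigma>(3) c by (auto simp: simplices_piece)
  then show "r \<in> piece_values c w" using \<sigma> by (auto simp: component_critical_values_iff)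
qed

text \<open>Merges the two child rules: comparing \<open>d\<close> with the direction of
  \<open>x\<close> selects the endpoint.\<close>

lemma induced_node_snocE:
  assumes "induced_node T f (x @ [d]) c'"
  obtains c u v where "induced_node T f x c" "{u, v} \<in> edges T" "critical T f {u, v}"
    "c = f {u, v}" "Min (piece_values c u) < Min (piece_values c v)"
    "c' = Max (piece_values c (if d = node_direction x then u else v))"
  using assms by cases auto

text \<open>Each step down passes to the component of an end of an edge that already lies in the
  component of \<open>w\<close>, and such components are nested.\<close>

lemma induced_node_descendant:
  assumes "induced_node T f (x @ y) c'" "induced_node T f x (Max (piece_values c w))"
    and ne: "piece_values c w \<noteq> {}"
  shows "c' \<in> piece_values c w"
  using assms(1)
proof (induction y arbitrary: c' rule: rev_induct)
  case Nil
  then have "c' = Max (piece_values c w)" using assms(2) induced_node_label_unique by auto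
  then show ?case using Max_in finite_piece_values ne by simp
next
  case (snoc d y)
  then have "induced_node T f ((x @ y) @ [d]) c'" by simp
  then obtain b u v where b: "induced_node T f (x @ y) b" "{u, v} \<in> edges T"
      "critical T f {u, v}" "b = f {u, v}"
      "c' = Max (piece_values b (if d = node_direction (x @ y) then u else v))"
    by (elim induced_node_snocE)
  have "f {u, v} \<in> piece_values c w" using snoc.IH b by blast
  then obtain \<sigma> where "f {u, v} = f \<sigma>" "critical T f \<sigma>" "\<sigma> \<in> simplices (piece c w)"
    by (auto simp: component_critical_values_iff)
  \<comment> \<open>The simplex \<open>\<sigma>\<close> realizing the label is \<open>{u, v}\<close>
    itself, because critical values determine simplices.\<close>
  then have "{u, v} \<in> simplices (piece c w)" using b(3) critical_unique by metis
  then have uv: "{u, v} \<in> edges (piece c w)" using b(2) by (simp add: simplices_piece edges_piece)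
  then have vu: "{v, u} \<in> edges (piece c w)" by (simp add: insert_commute)
  have "piece_values b u \<subseteq> piece_values c w" "piece_values b v \<subseteq> piece_values c w"
    using piece_values_mono[OF uv] piece_values_mono[OF vu] b(4) by (auto simp: insert_commute)
  moreover have "Max (piece_values b u) \<in> piece_values b u"
      "Max (piece_values b v) \<in> piece_values b v"
    using critical_edge_piece_values[OF b(2,3)] b(4) finite_piece_values by auto
  ultimately show ?case using b(5) by auto
qed

lemma induced_node_prefix:
  "induced_node T f (x @ y) c \<Longrightarrow> \<exists>b. induced_node T f x b"
proof (induction y arbitrary: c rule: rev_induct)
  case (snoc d y)
  then have "induced_node T f ((x @ y) @ [d]) c" by simp
  then show ?case using snoc.IH by (elim induced_node_snocE)
qed auto

text \<open>The child \<open>x @ [d]\<close> is labeled by the maximum of one component at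
  \<open>x\<close>, so all labels under it come from that component.\<close>

lemma induced_node_ConsE:
  assumes "induced_node T f (x @ d # y) c'"
  obtains c u v where "induced_node T f x c" "{u, v} \<in> edges T" "critical T f {u, v}"
    "c = f {u, v}" "Min (piece_values c u) < Min (piece_values c v)"
    "c' \<in> piece_values c (if d = node_direction x then u else v)"
proof -
  have *: "induced_node T f ((x @ [d]) @ y) c'" using assms by simp
  then obtain b where b: "induced_node T f (x @ [d]) b" using induced_node_prefix by blast
  from b obtain c u v where c: "induced_node T f x c" "{u, v} \<in> edges T" "critical T f {u, v}"
    "c = f {u, v}" "Min (piece_values c u) < Min (piece_values c v)"
    "b = Max (piece_values c (if d = node_direction x then u else v))"
    by (elim induced_node_snocE)
  then have "c' \<in> piece_values c (if d = node_direction x then u else v)"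
    using induced_node_descendant[OF *] b critical_edge_piece_values by (auto split: if_splits)
  with c that show thesis by blast
qed

lemma induced_node_label_decreasing:
  assumes "induced_node T f x c" "induced_node T f (x @ d # y) c'"
  shows "c' < c"
  using assms(2) by (elim induced_node_ConsE)
    (use assms(1) induced_node_label_unique piece_values_less in metis)

text \<open>The two subtrees below \<open>x\<close> draw their labels from the components of the two
  ends of the edge at \<open>x\<close>, and these share no critical value.\<close>

lemma induced_node_label_branch:
  assumes "induced_node T f (x @ d # y) c" "induced_node T f (x @ d' # y') c'" "d \<noteq> d'"
  shows "c \<noteq> c'"
proof -
  obtain b u v where b: "induced_node T f x b" "{u, v} \<in> edges T" "critical T f {u, v}"
    "b = f {u, v}" "Min (piece_values b u) < Min (piece_values b v)"
    "c \<in> piece_values b (if d = node_direction x then u else v)"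
    using assms(1) by (elim induced_node_ConsE)
  obtain b' u' v' where b': "induced_node T f x b'" "{u', v'} \<in> edges T" "critical T f {u', v'}"
    "b' = f {u', v'}" "Min (piece_values b' u') < Min (piece_values b' v')"
    "c' \<in> piece_values b' (if d' = node_direction x then u' else v')"
    using assms(2) by (elim induced_node_ConsE)
  have "b' = b" using b b' induced_node_label_unique by metis
  then have "{u', v'} = {u, v}" using b b' critical_unique by metis
  \<comment> \<open>The strict inequality of the minima fixes which end plays the role of
    \<open>u\<close>, so both derivations use the same orientation.\<close>
  then have "u' = u \<and> v' = v" using b(5) b'(5) \<open>b' = b\<close> by (auto simp: doubleton_eq_iff)
  moreover have "d = node_direction x \<longleftrightarrow> d' \<noteq> node_direction x"
    using assms(3) by (metis direction.exhaust)
  ultimately show ?thesis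
    using piece_values_disjoint[OF b(2)] b b' \<open>b' = b\<close> by (auto split: if_splits)
qed

text \<open>Of two distinct words, either one is a proper prefix of the other, where labels decrease
  strictly, or they split at a first differing letter, where the labels lie in disjoint
  sets.\<close>

lemma induced_node_label_inj:
  assumes "induced_node T f x c" "induced_node T f y c"
  shows "x = y"
proof (rule ccontr)
  assume "x \<noteq> y"
  then consider d z where "y = x @ d # z" | d z where "x = y @ d # z" | "x \<parallel> y"
    unfolding parallel_def prefix_def by (metis append_Nil2 list.exhaust)
  then show False
  proof cases
    case 3
    then obtain as b bs b' bs' where "b \<noteq> b'" "x = as @ b # bs" "y = as @ b' # bs'"
      using parallel_decomp by metis
    then show False using assms induced_node_label_branch by blast
  qed (use assms induced_node_label_decreasing in blast)+
qed

end

section \<open>Leaves and impasses of full binary trees\<close>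

lemma neighbors_underlying:
  assumes "full_binary_tree M"
  shows "neighbors (underlying_graph M) x =
    (if x \<in> nodes M then {x @ [d] | d. x @ [d] \<in> nodes M} \<union> (if x = [] then {} else {butlast x})
     else {})"
proof -
  have parent: "butlast x \<in> nodes M" if "x \<in> nodes M" "x \<noteq> []"
    using assms that unfolding full_binary_tree_def by (metis append_butlast_last_id)
  have child: "(\<exists>d. x = y @ [d]) \<longleftrightarrow> x \<noteq> [] \<and> y = butlast x" for y :: node
    by (metis append_butlast_last_id butlast_snoc snoc_eq_iff_butlast)
  have "y \<in> neighbors (underlying_graph M) x \<longleftrightarrow> x \<in> nodes M \<and> y \<in> nodes M \<and>
      ((\<exists>d. y = x @ [d]) \<or> (\<exists>d. x = y @ [d]))" for y
    by (auto simp: neighbors_def adjacent_def underlying_graph_def doubleton_eq_iff)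
  then show ?thesis
    unfolding child using parent by (auto split: if_splits)
qed

lemma children_full_binary_tree:
  assumes "full_binary_tree M" "x @ [d] \<in> nodes M"
  shows "x @ [d'] \<in> nodes M"
proof -
  have "x \<in> nodes M" using assms unfolding full_binary_tree_def by blast
  then have "x @ [Left] \<in> nodes M \<longleftrightarrow> x @ [Right] \<in> nodes M"
    using assms(1) unfolding full_binary_tree_def by blast
  then show ?thesis using assms(2) by (cases d; cases d') simp_all
qed

lemma finite_neighbors_underlying:
  assumes "full_binary_tree M"
  shows "finite (neighbors (underlying_graph M) x)"
proof -
  have "{x @ [d] | d. x @ [d] \<in> nodes M} \<subseteq> (\<lambda>d. x @ [d]) ` {Left, Right}"
    using direction.exhaust by auto
  then have "finite {x @ [d] | d. x @ [d] \<in> nodes M}" using finite_subset by blast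
  then show ?thesis unfolding neighbors_underlying[OF assms] by simp
qed

text \<open>In a full tree a node with one child has two, hence two neighbors. The count in
  \<open>leaf\<close> alone would also admit a root with a single child.\<close>

lemma leaf_no_children:
  assumes "full_binary_tree M" "leaf M x"
  shows "x @ [d] \<notin> nodes M"
proof
  assume "x @ [d] \<in> nodes M"
  then have "{x @ [Left], x @ [Right]} \<subseteq> neighbors (underlying_graph M) x"
    using assms children_full_binary_tree[OF assms(1)]
    by (auto simp: neighbors_underlying leaf_def)
  then have "card {x @ [Left], x @ [Right]} \<le> card (neighbors (underlying_graph M) x)"
    using finite_neighbors_underlying assms(1) card_mono by blast
  then show False using assms(2) by (simp add: leaf_def)
qed

text \<open>The parent of \<open>x\<close> has the child \<open>x\<close> and so is no leaf; the two
  leaves adjacent to \<open>x\<close> can only be its two children.\<close>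

lemma impasse_children:
  assumes M: "full_binary_tree M" and x: "x \<in> impasses M"
  shows "x @ [d] \<in> nodes M" "x @ [d, d'] \<notin> nodes M"
proof -
  let ?L = "{y \<in> neighbors (underlying_graph M) x. leaf M y}"
  have xM: "x \<in> nodes M" and L: "card ?L = 2"
    using x by (auto simp: impasses_def internal_def)
  have "\<not> leaf M (butlast x)" if "x \<noteq> []"
    using leaf_no_children[OF M, of "butlast x" "last x"] that xM by auto
  then have "?L \<subseteq> {x @ [Left], x @ [Right]}"
    using direction.exhaust by (auto simp: neighbors_underlying[OF M] split: if_splits)
  then have "?L = {x @ [Left], x @ [Right]}"
    using L by (intro card_subset_eq) auto
  then have "x @ [d] \<in> ?L" for d by (cases d) auto
  then have leaf: "leaf M (x @ [d])" for d by simp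
  show "x @ [d] \<in> nodes M" using leaf by (simp add: leaf_def)
  show "x @ [d, d'] \<notin> nodes M" using leaf_no_children[OF M leaf, of d d'] by simp
qed

section \<open>Edges of impasses and the matching they form\<close>

context morse_tree
begin

abbreviation "M \<equiv> induced_merge_tree T f"

lemma nodes_iff: "x \<in> nodes M \<longleftrightarrow> (\<exists>c. induced_node T f x c)"
  by (simp add: induced_merge_tree_def)

lemma label_eq: "induced_node T f x c \<Longrightarrow> label M x = c"
  by (auto simp: induced_merge_tree_def intro: the_equality induced_node_label_unique)

lemma corresponding_edge_eq:
  assumes "induced_node T f x (f e)" "e \<in> edges T" "critical T f e"
  shows "corresponding_edge T f M x = e"
  unfolding corresponding_edge_def label_eq[OF assms(1)]
  using assms by (intro the_equality) (simp_all add: critical_unique[of T f])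

text \<open>A critical edge in one of the two components would make the label of the corresponding
  child the value of a critical edge, and that child would have children itself.\<close>

lemma impasse_edge:
  assumes "x \<in> impasses M"
  obtains e where "corresponding_edge T f M x = e" "induced_node T f x (f e)"
    "e \<in> edges T" "critical T f e"
    "\<forall>w \<in> e. \<forall>e' \<in> edges (piece (f e) w). \<not> critical T f e'"
proof -
  note children = impasse_children[OF full_binary_tree_induced_merge_tree assms]
  \<comment> \<open>An arbitrary choice: the existence of either child reveals the edge at
    \<open>x\<close>.\<close>
  let ?d = "node_direction x"
  have "\<exists>c. induced_node T f (x @ [?d]) c" using children(1) nodes_iff by blast
  then obtain u v where uv: "induced_node T f x (f {u, v})" "{u, v} \<in> edges T"
      "critical T f {u, v}"
      "Min (piece_values (f {u, v}) u) < Min (piece_values (f {u, v}) v)"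
    unfolding induced_node_child_iff by blast
  have "\<not> critical T f e'" if w: "w \<in> {u, v}" and e': "e' \<in> edges (piece (f {u, v}) w)" for w e'
  proof
    assume "critical T f e'"
    with e' obtain e'' where e'': "e'' \<in> edges T" "critical T f e''"
        "Max (piece_values (f {u, v}) w) = f e''"
      using Max_piece_values_edge by metis
    obtain d where "induced_node T f (x @ [d]) (Max (piece_values (f {u, v}) w))"
      using w induced_node.same_direction[OF uv(1-3) refl uv(4)]
        induced_node.opposite_direction[OF uv(1-3) refl uv(4)] by blast
    \<comment> \<open>\<open>Left\<close> is arbitrary too, as any grandchild of \<open>x\<close>
      gives the contradiction.\<close>
    then have "\<exists>c. induced_node T f ((x @ [d]) @ [Left]) c"
      using e'' induced_node_child_ex by metis
    then show False using children(2)[of d Left] by (simp add: nodes_iff)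
  qed
  then show thesis using that corresponding_edge_eq uv by metis
qed

lemma matching_impasse_edges: "matching T (corresponding_edge T f M ` impasses M)"
proof -
  have disj: "e1 \<inter> e2 = {}"
    if "e1 \<in> edges T" "critical T f e1" "e2 \<in> edges T" "critical T f e2" "f e1 < f e2"
      and no: "\<forall>w \<in> e2. \<forall>e' \<in> edges (piece (f e2) w). \<not> critical T f e'" for e1 e2
  proof (rule ccontr)
    assume "e1 \<inter> e2 \<noteq> {}"
    then obtain v where v: "v \<in> e1" "v \<in> e2" by blast
    \<comment> \<open>Needs \<open>f {v} < f e2\<close>, which holds because \<open>e2\<close> is
      critical.\<close>
    then have "v \<in> verts (piece (f e2) v)"
      using that edge_subset critical_edge_gt by (auto simp: verts_piece)
    then have "e1 \<in> edges (piece (f e2) v)" using edge_in_piece that v by blast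
    then show False using no v that by blast
  qed
  have "corresponding_edge T f M x \<inter> corresponding_edge T f M y = {}"
    if x: "x \<in> impasses M" and y: "y \<in> impasses M"
      and neq: "corresponding_edge T f M x \<noteq> corresponding_edge T f M y" for x y
  proof -
    obtain e1 where e1: "corresponding_edge T f M x = e1" "e1 \<in> edges T" "critical T f e1"
      "\<forall>w \<in> e1. \<forall>e' \<in> edges (piece (f e1) w). \<not> critical T f e'"
      using impasse_edge[OF x] by metis
    obtain e2 where e2: "corresponding_edge T f M y = e2" "e2 \<in> edges T" "critical T f e2"
      "\<forall>w \<in> e2. \<forall>e' \<in> edges (piece (f e2) w). \<not> critical T f e'"
      using impasse_edge[OF y] by metis
    \<comment> \<open>Distinct critical edges differ in value, so one of them is the lower one
      required by \<open>disj\<close>.\<close>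
    have "f e1 \<noteq> f e2" using neq e1 e2 critical_unique by metis
    then consider "f e1 < f e2" | "f e2 < f e1" by linarith
    then show ?thesis
    proof cases
      case 1
      then show ?thesis using disj[of e1 e2] e1 e2 by blast
    next
      case 2
      then show ?thesis using disj[of e2 e1] e1 e2 by blast
    qed
  qed
  moreover have "corresponding_edge T f M x \<in> edges T" if "x \<in> impasses M" for x
    using impasse_edge[OF that] by metis
  ultimately show ?thesis unfolding matching_def by blast
qed

text \<open>The label of an impasse is the value of its edge, so equal edges give equal labels and
  hence equal nodes.\<close>

lemma inj_on_corresponding_edge: "inj_on (corresponding_edge T f M) (impasses M)"
proof (rule inj_onI)
  fix x y
  assume "x \<in> impasses M" "y \<in> impasses M"
    and eq: "corresponding_edge T f M x = corresponding_edge T f M y"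
  then have "induced_node T f x (f (corresponding_edge T f M x))"
      "induced_node T f y (f (corresponding_edge T f M y))"
    by (metis impasse_edge)+
  with eq show "x = y" using induced_node_label_inj by metis
qed

text \<open>There are only finitely many matchings, so \<open>Max\<close> in
  \<open>matching_number\<close> is a genuine upper bound.\<close>

lemma card_matching_le:
  assumes "matching T m"
  shows "card m \<le> matching_number T"
proof -
  have "{m. matching T m} \<subseteq> Pow (edges T)" by (auto simp: matching_def)
  then have "finite {m. matching T m}" using finite_edges finite_subset by blast
  then show ?thesis using assms unfolding matching_number_def by (intro Max_ge) auto
qed

end

theorem proposition13:
  fixes T :: "'a graph" and f :: "'a set \<Rightarrow> real" and M :: labeled_binary_tree
  assumes "is_tree T"
    and "discrete_morse T f"
    and "M = induced_merge_tree T f"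
  shows "matching T (corresponding_edge T f M ` impasses M)
       \<and> num_impasses M \<le> matching_number T"
proof -
  interpret morse_tree T f using assms by unfold_locales
  have "num_impasses M = card (corresponding_edge T f M ` impasses M)"
    using card_image[OF inj_on_corresponding_edge] assms(3) by (simp add: num_impasses_def)
  then show ?thesis
    using matching_impasse_edges card_matching_le assms(3) by simp
qed

end
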